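(* For every positive integer $n$ and every symmetrizable $n\times n$ integer matrix $A=(a_{ij})$, the algorithm SymmetrizerMatrix (described in the context) is correct: on input $A$ it terminates and returns a diagonal matrix $D=\mathrm{diag}(d_{11},\dots,d_{nn})$ with positive diagonal entries such that $D\times A$ is symmetric.
   Context: A square integer matrix $A$ is symmetrizable if there is a diagonal real matrix $D$ with positive diagonal entries such that $D\times A$ is symmetric; such a $D$ is called a symmetrizer of $A$. Algorithm SymmetrizerMatrix($A$), for $A$ a symmetrizable $n\times n$ integer matrix: (1) Set $d_{ii}\leftarrow 0$ for all $i\in\{1,\dots,n\}$; let $S$ be the set $\{1,\dots,n\}$ and let $T$ be the ordered list $(1,\dots,n)$. (2) While $S\neq\varnothing$: let $i$ be the first element of $T$ and remove $i$ from $T$. If $d_{ii}=0$, set $d_{ii}\leftarrow 1$ and remove $i$ from $S$. Then, for each $j$ in $T$ (traversing each element that is in $T$ at the start of this inner loop exactly once): if $a_{ji}\neq 0$, move $j$ to the first position of $T$ and, if moreover $d_{jj}=0$, set $d_{jj}\leftarrow d_{ii}a_{ij}/a_{ji}$ and remove $j$ from $S$. (3) When $S$ is empty, return the diagonal matrix $D$ with diagonal entries $d_{11},\dots,d_{nn}$. *)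

theory Defs
  imports "Jordan_Normal_Form.Matrix" "HOL-Library.While_Combinator"
begin

text \<open>Rows and columns are numbered from 0 to n - 1, as in the matrix library.\<close>

definition symmetrizer :: "int mat \<Rightarrow> real mat \<Rightarrow> bool" where
  "symmetrizer A D \<longleftrightarrow>
     D \<in> carrier_mat (dim_row A) (dim_row A) \<and> diagonal_mat D \<and>
     (\<forall>i < dim_row A. D $$ (i,i) > 0) \<and>
     transpose_mat (D * map_mat real_of_int A) = D * map_mat real_of_int A"

definition symmetrizable :: "int mat \<Rightarrow> bool" where
  "symmetrizable A \<longleftrightarrow> square_mat A \<and> (\<exists>D. symmetrizer A D)"

text \<open>A state \<open>(d, S, T)\<close> of the algorithm holds the diagonal entries
  \<open>d i\<close>, the set \<open>S\<close> and the ordered list \<open>T\<close>.\<close>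

type_synonym sm_state = "(nat \<Rightarrow> real) \<times> nat set \<times> nat list"

definition sm_init :: "nat \<Rightarrow> sm_state" where
  "sm_init n = ((\<lambda>_. 0), {0..<n}, [0..<n])"

definition sm_start :: "nat \<Rightarrow> sm_state \<Rightarrow> sm_state" where
  "sm_start i = (\<lambda>(d, S, T). if d i = 0 then (d(i := 1), S - {i}, T) else (d, S, T))"

definition sm_visit :: "int mat \<Rightarrow> nat \<Rightarrow> nat \<Rightarrow> sm_state \<Rightarrow> sm_state" where
  "sm_visit A i j = (\<lambda>(d, S, T).
     if A $$ (j,i) \<noteq> 0 then
       let T' = j # remove1 j T in
       if d j = 0
       then (d(j := d i * real_of_int (A $$ (i,j)) / real_of_int (A $$ (j,i))), S - {j}, T')
       else (d, S, T')
     else (d, S, T))"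

text \<open>One iteration of the while loop. The inner loop runs over a snapshot \<open>T\<close> of the
  list, in list order, while the list component of the state is being reordered.
  If \<open>T\<close> is empty there is no first element to take; the state is then left unchanged, so
  that a run reaching this point with \<open>S\<close> nonempty does not terminate and returns nothing.\<close>

definition sm_step :: "int mat \<Rightarrow> sm_state \<Rightarrow> sm_state" where
  "sm_step A = (\<lambda>(d, S, T0). case T0 of
       [] \<Rightarrow> (d, S, [])
     | i # T \<Rightarrow> fold (sm_visit A i) T (sm_start i (d, S, T)))"

text \<open>The result is \<open>None\<close> exactly if the while loop does not terminate.\<close>

definition SymmetrizerMatrix :: "int mat \<Rightarrow> real mat option" where
  "SymmetrizerMatrix A =
     map_option (\<lambda>(d, S, T). mat_diag (dim_row A) d)
       (while_option (\<lambda>(d, S, T). S \<noteq> {}) (sm_step A) (sm_init (dim_row A)))"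

end

theory Submission
  imports Defs
begin

text \<open>Let \<open>e\<close> be the diagonal of some symmetrizer. Moving visited indices to the front keeps the
  indices with \<open>d \<noteq> 0\<close> at the front of \<open>T\<close>, and on \<open>T\<close> they all have the same ratio
  \<open>d x / e x\<close>. Every index that has left \<open>T\<close> has the same ratio as each of its neighbours. Hence
  when the first element \<open>i\<close> of \<open>T\<close> has \<open>d i = 0\<close>, no index of \<open>T\<close> is adjacent to one that has
  left \<open>T\<close>, and a new ratio may be chosen freely. Once \<open>d\<close> is positive everywhere, neighbours have
  equal ratios, which is the symmetry of \<open>D * A\<close>.\<close>

locale symmetrizing_weights =
  fixes A :: "int mat" and n :: nat and e :: "nat \<Rightarrow> real"
  assumes weight_pos: "x < n \<Longrightarrow> e x > 0"
    and weight_symm: "x < n \<Longrightarrow> y < n \<Longrightarrow> e x * real_of_int (A $$ (x,y)) = e y * real_of_int (A $$ (y,x))"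
begin

lemma entry_zero_iff:
  assumes "x < n" "y < n"
  shows "A $$ (x,y) = 0 \<longleftrightarrow> A $$ (y,x) = 0"
  using weight_symm[OF assms] weight_pos[OF assms(1)] weight_pos[OF assms(2)] by auto

text \<open>The ratio \<open>c\<close> is a parameter because it stays fixed throughout an inner
  loop. The \<open>sorted_wrt\<close> clause encodes that the nonzero entries form an initial
  segment of the list, so a zero at the head forces zeros throughout.\<close>

fun frontier_invariant :: "real \<Rightarrow> sm_state \<Rightarrow> bool" where
  "frontier_invariant c (d, S, T) \<longleftrightarrow>
     distinct T \<and> set T \<subseteq> {..<n} \<and> S = {x. x < n \<and> d x = 0} \<and>
     sorted_wrt (\<lambda>x y. d y \<noteq> 0 \<longrightarrow> d x \<noteq> 0) T \<and>
     (\<forall>x \<in> set T. d x = 0 \<or> d x = c * e x)"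

text \<open>Here \<open>c\<close> is existential, since it may change between iterations. The last
  equation is the equality of the ratios \<open>d x / e x\<close> and \<open>d y / e y\<close>
  without division; the neighbour \<open>y\<close> may still lie in \<open>T\<close>.\<close>

fun sm_invariant :: "sm_state \<Rightarrow> bool" where
  "sm_invariant (d, S, T) \<longleftrightarrow>
     (\<exists>c > 0. frontier_invariant c (d, S, T)) \<and>
     (\<forall>x < n. x \<notin> set T \<longrightarrow> d x > 0 \<and>
        (\<forall>y < n. A $$ (x,y) \<noteq> 0 \<longrightarrow> d x * e y = d y * e x))"

text \<open>By \<open>weight_symm\<close> a newly assigned value is \<open>c * e j\<close>, so the
  common ratio persists. An index moved to the front has a nonzero entry, so the nonzero entries
  still come first.\<close>

lemma sm_visit_frontier:
  assumes "frontier_invariant c (d, S, T)" "c > 0" "i < n" "d i = c * e i" "j \<in> set T"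
    and "sm_visit A i j (d, S, T) = (d', S', T')"
  shows "frontier_invariant c (d', S', T') \<and> set T' = set T \<and>
    (\<forall>x. d x \<noteq> 0 \<or> x \<notin> set T \<longrightarrow> d' x = d x) \<and> (A $$ (j,i) \<noteq> 0 \<longrightarrow> d' j \<noteq> 0)"
proof (cases "A $$ (j,i) = 0")
  case True
  then show ?thesis using assms by (auto simp: sm_visit_def)
next
  case False
  have j: "j < n" using assms by auto
  have T': "T' = j # remove1 j T" and d': "d' = (if d j = 0 then d(j := c * e j) else d)"
    and S': "S' = (if d j = 0 then S - {j} else S)"
  proof -
    have "d i * real_of_int (A $$ (i,j)) / real_of_int (A $$ (j,i)) = c * e j"
      using assms(4) weight_symm[OF assms(3) j] False by (simp add: field_simps)
    then show "T' = j # remove1 j T" "d' = (if d j = 0 then d(j := c * e j) else d)"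
      "S' = (if d j = 0 then S - {j} else S)"
      using assms(6) False by (auto simp: sm_visit_def Let_def split: if_splits)
  qed
  have dj: "d' j \<noteq> 0" using d' weight_pos[OF j] assms(2) by auto
  have dist: "distinct T" and srt: "sorted_wrt (\<lambda>x y. d y \<noteq> 0 \<longrightarrow> d x \<noteq> 0) T"
    using assms(1) by auto
  \<comment> \<open>Only entry \<open>j\<close> can change, and by distinctness \<open>j\<close> is
    absent from the tail, so the order condition passes there from \<open>d\<close> to
    \<open>d'\<close>.\<close>
  have same: "d' x = d x" if "x \<in> set (remove1 j T)" for x
    using that dist d' by auto
  have "sorted_wrt (\<lambda>x y. d y \<noteq> 0 \<longrightarrow> d x \<noteq> 0) (remove1 j T)"
    using srt by (induction T) (auto dest!: subsetD[OF set_remove1_subset])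
  then have "sorted_wrt (\<lambda>x y. d' y \<noteq> 0 \<longrightarrow> d' x \<noteq> 0) (remove1 j T)"
    by (rule sorted_wrt_mono_rel[rotated]) (simp add: same)
  then have "sorted_wrt (\<lambda>x y. d' y \<noteq> 0 \<longrightarrow> d' x \<noteq> 0) T'"
    using dj T' by simp
  moreover have "S' = {x. x < n \<and> d' x = 0}"
    using assms(1) S' d' dj by (auto split: if_splits)
  ultimately show ?thesis
    using T' d' dj dist assms(1,5) by auto
qed

text \<open>The traversed part \<open>L\<close> of the snapshot is kept apart from the list, which
  is permuted on the way; only its set is stable. As \<open>i\<close> is outside \<open>T\<close>,
  no visit alters \<open>d i\<close>.\<close>

lemma sm_visits_frontier:
  assumes "frontier_invariant c (d, S, T)" "c > 0" "i < n" "i \<notin> set T" "d i = c * e i"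
    and "set L \<subseteq> set T" "fold (sm_visit A i) L (d, S, T) = (d', S', T')"
  shows "frontier_invariant c (d', S', T') \<and> set T' = set T \<and>
    (\<forall>x. d x \<noteq> 0 \<or> x \<notin> set T \<longrightarrow> d' x = d x) \<and> (\<forall>x \<in> set L. A $$ (x,i) \<noteq> 0 \<longrightarrow> d' x \<noteq> 0)"
  using assms(6,7)
\<comment> \<open>Induction from the right fits \<open>fold\<close>: the hypothesis describes the
  state just before the last visit.\<close>
proof (induction L arbitrary: d' S' T' rule: rev_induct)
  case Nil
  then show ?case using assms by auto
next
  case (snoc j L)
  obtain d1 S1 T1 where s1: "fold (sm_visit A i) L (d, S, T) = (d1, S1, T1)"
    by (metis prod_cases3)
  have IH: "frontier_invariant c (d1, S1, T1)" "set T1 = set T"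
    "\<And>x. d x \<noteq> 0 \<or> x \<notin> set T \<Longrightarrow> d1 x = d x"
    "\<And>x. x \<in> set L \<Longrightarrow> A $$ (x,i) \<noteq> 0 \<Longrightarrow> d1 x \<noteq> 0"
    using snoc.IH[OF _ s1] snoc.prems by auto
  have "d1 i = c * e i" using IH(3) assms(4,5) by simp
  moreover have "j \<in> set T1" using IH(2) snoc.prems by simp
  moreover have "sm_visit A i j (d1, S1, T1) = (d', S', T')"
    using snoc.prems(2) s1 by simp
  ultimately have "frontier_invariant c (d', S', T') \<and> set T' = set T1 \<and>
    (\<forall>x. d1 x \<noteq> 0 \<or> x \<notin> set T1 \<longrightarrow> d' x = d1 x) \<and> (A $$ (j,i) \<noteq> 0 \<longrightarrow> d' j \<noteq> 0)"
    by (intro sm_visit_frontier[OF IH(1) assms(2,3)])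
  then show ?case using IH(2-4) by (auto simp del: frontier_invariant.simps)
qed

text \<open>If \<open>d i\<close> is nonzero, the old ratio serves. Otherwise \<open>d\<close>
  vanishes on all of \<open>T\<close>, which leaves the ratio free, and \<open>1 / e i\<close> is
  the one that fits \<open>d1 i = 1\<close>.\<close>

lemma sm_start_frontier:
  assumes "sm_invariant (d, S, i # T)" "sm_start i (d, S, T) = (d1, S1, T1)"
  shows "\<exists>c > 0. frontier_invariant c (d1, S1, T) \<and> T1 = T \<and> d1 i = c * e i \<and>
    (\<forall>x. x \<noteq> i \<longrightarrow> d1 x = d x) \<and> (d i \<noteq> 0 \<longrightarrow> d1 i = d i)"
proof -
  obtain c where c: "c > 0" "frontier_invariant c (d, S, i # T)"
    using assms(1) by auto
  have i: "i < n" using c by auto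
  show ?thesis
  proof (cases "d i = 0")
    case False
    then show ?thesis using assms(2) c by (intro exI[of _ c]) (auto simp: sm_start_def)
  next
    case True
    have zero: "d x = 0" if "x \<in> set T" for x
      using c(2) that True by auto
    have d1: "d1 = d(i := 1)" "S1 = S - {i}" "T1 = T"
      using assms(2) True by (auto simp: sm_start_def)
    have zero1: "d1 x = 0" if "x \<in> set T" for x
      using c(2) d1(1) zero that by auto
    then have "sorted_wrt (\<lambda>x y. d1 y \<noteq> 0 \<longrightarrow> d1 x \<noteq> 0) T"
      by (simp add: sorted_wrt_iff_nth_less)
    moreover have "S1 = {x. x < n \<and> d1 x = 0}"
      using c(2) by (auto simp: d1)
    ultimately have "frontier_invariant (1 / e i) (d1, S1, T)"
      using c(2) zero1 by simp
    then show ?thesis using d1 True weight_pos[OF i]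
      by (intro exI[of _ "1 / e i"]) (simp del: frontier_invariant.simps)
  qed
qed

text \<open>Only \<open>i\<close> leaves the list. Its neighbours in \<open>T\<close> have ratio
  \<open>c\<close> after the inner loop; for neighbours that left earlier, the old invariant already
  gives the equation.\<close>

lemma sm_step_invariant:
  assumes inv: "sm_invariant (d, S, i # T)" and step: "sm_step A (d, S, i # T) = (d', S', T')"
  shows "sm_invariant (d', S', T') \<and> set T' = set T"
proof -
  obtain d1 S1 T1 where st: "sm_start i (d, S, T) = (d1, S1, T1)" by (metis prod_cases3)
  obtain c where c: "c > 0" "frontier_invariant c (d1, S1, T)" "T1 = T" "d1 i = c * e i"
    and d1: "\<And>x. x \<noteq> i \<Longrightarrow> d1 x = d x" "d i \<noteq> 0 \<Longrightarrow> d1 i = d i"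
    using sm_start_frontier[OF inv st] by auto
  have i: "i < n" "i \<notin> set T" and T: "set T \<subseteq> {..<n}" using inv by auto
  have fold: "fold (sm_visit A i) T (d1, S1, T) = (d', S', T')"
    using step st c(3) by (simp add: sm_step_def)
  have front: "frontier_invariant c (d', S', T')" "set T' = set T"
    and d': "\<And>x. d1 x \<noteq> 0 \<or> x \<notin> set T \<Longrightarrow> d' x = d1 x"
    and nb: "\<And>x. x \<in> set T \<Longrightarrow> A $$ (x,i) \<noteq> 0 \<Longrightarrow> d' x \<noteq> 0"
    using sm_visits_frontier[OF c(2,1) i c(4) _ fold] by auto
  have keep: "d' x = d x" if "d x \<noteq> 0" for x
    using that d1 d' by (metis (full_types))
  have d'i: "d' i = c * e i" using d' i c(4) by simp
  have old: "d x > 0" "\<And>y. y < n \<Longrightarrow> A $$ (x,y) \<noteq> 0 \<Longrightarrow> d x * e y = d y * e x"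
    if "x < n" "x \<notin> set T" "x \<noteq> i" for x
    using inv that by auto
  have old': "d' x > 0" "\<And>y. y < n \<Longrightarrow> A $$ (x,y) \<noteq> 0 \<Longrightarrow> d' x * e y = d' y * e x"
    if x: "x < n" "x \<notin> set T" "x \<noteq> i" for x
  proof -
    show "d' x > 0" using old(1)[OF x] keep[of x] by simp
    fix y assume y: "y < n" "A $$ (x,y) \<noteq> 0"
    \<comment> \<open>The left side of the ratio equation is positive, so a neighbour of a departed
      index is already assigned and is never overwritten. In particular, if \<open>d i = 0\<close>,
      then \<open>i\<close> has no departed neighbour.\<close>
    have "d y \<noteq> 0" using old(2)[OF x y] old(1)[OF x] weight_pos[OF y(1)] by auto
    then show "d' x * e y = d' y * e x"
      using old(2)[OF x y] old(1)[OF x] keep[of x] keep[of y] by simp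
  qed
  have new: "d' i * e y = d' y * e i" if y: "y < n" "A $$ (i,y) \<noteq> 0" for y
  proof -
    have sym: "A $$ (y,i) \<noteq> 0" using entry_zero_iff[OF i(1) y(1)] y(2) by simp
    consider "y = i" | "y \<in> set T" | "y \<noteq> i" "y \<notin> set T" by auto
    then show ?thesis
    proof cases
      case 2
      then have "d' y = c * e y" using nb[OF 2 sym] front by auto
      then show ?thesis using d'i by simp
    next
      case 3
      then show ?thesis using old'(2)[OF y(1) _ _ i(1) sym] by simp
    qed simp
  qed
  have "d' i > 0" using d'i c(1) weight_pos[OF i(1)] by simp
  then have "\<forall>x < n. x \<notin> set T' \<longrightarrow> d' x > 0 \<and>
        (\<forall>y < n. A $$ (x,y) \<noteq> 0 \<longrightarrow> d' x * e y = d' y * e x)"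
    using old' new front(2) by metis
  then show ?thesis using front c(1) by (auto simp del: frontier_invariant.simps)
qed

lemma sm_loop_terminates:
  "\<exists>d T. while_option (\<lambda>(d, S, T). S \<noteq> {}) (sm_step A) (sm_init n) = Some (d, {}, T) \<and>
     sm_invariant (d, {}, T)"
proof -
  have init: "sm_invariant (sm_init n)"
    by (auto simp: sm_init_def sorted_wrt_iff_nth_less intro!: exI[of _ 1])
  have step: "sm_invariant (sm_step A s) \<and>
      length (snd (snd (sm_step A s))) < length (snd (snd s))"
    if inv: "sm_invariant s" and b: "(\<lambda>(d, S, T). S \<noteq> {}) s" for s
  proof -
    obtain d S T0 where s: "s = (d, S, T0)" by (metis prod_cases3)
    \<comment> \<open>Indices in \<open>S\<close> have entry 0, while those outside the list have
      positive entries; so the idle branch of \<open>sm_step\<close> is never reached and the list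
      length can serve as the measure.\<close>
    have "T0 \<noteq> []" using inv b s by force
    then obtain i T where T0: "T0 = i # T" by (cases T0) auto
    obtain d' S' T' where s': "sm_step A s = (d', S', T')" by (metis prod_cases3)
    have *: "sm_invariant (d', S', T')" "set T' = set T"
      using sm_step_invariant[of d S i T d' S' T'] inv s' s T0 by auto
    have "distinct T'" "distinct T" using *(1) inv s T0 by auto
    then have "length T' = length T" using *(2) by (metis distinct_card)
    then show ?thesis using *(1) s s' T0 by (simp del: sm_invariant.simps)
  qed
  obtain t where t: "while_option (\<lambda>(d, S, T). S \<noteq> {}) (sm_step A) (sm_init n) = Some t"
    using measure_while_option_Some[where P = sm_invariant and b = "\<lambda>(d, S, T). S \<noteq> {}"
        and f = "\<lambda>s. length (snd (snd s))" and c = "sm_step A", OF _ init] step by metis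
  have "sm_invariant t"
    using while_option_rule[where P = sm_invariant, OF _ t init] step by blast
  with t while_option_stop[OF t] show ?thesis by (cases t) (simp del: sm_invariant.simps)
qed

lemma sm_invariant_final:
  assumes "sm_invariant (d, {}, T)"
  shows "x < n \<Longrightarrow> d x > 0"
    and "x < n \<Longrightarrow> y < n \<Longrightarrow> d x * real_of_int (A $$ (x,y)) = d y * real_of_int (A $$ (y,x))"
proof -
  obtain c where c: "c > 0" "frontier_invariant c (d, {}, T)" using assms by auto
  \<comment> \<open>The list may be nonempty at the end, but with \<open>S\<close> empty the
    alternative \<open>d x = 0\<close> is excluded on it.\<close>
  have T: "d x = c * e x" if "x \<in> set T" for x
    using c(2) that by auto
  have ratio: "d x * e y = d y * e x" if "x < n" "y < n" "x \<notin> set T" "A $$ (x,y) \<noteq> 0" for x y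
    using assms that unfolding sm_invariant.simps by blast
  show pos: "d x > 0" if "x < n" for x
    using assms T[of x] c(1) weight_pos[OF that] that by (cases "x \<in> set T") auto
  assume x: "x < n" and y: "y < n"
  show "d x * real_of_int (A $$ (x,y)) = d y * real_of_int (A $$ (y,x))"
  proof (cases "A $$ (x,y) = 0")
    case True
    then show ?thesis using entry_zero_iff[OF x y] by simp
  next
    case False
    have "d x * e y = d y * e x"
    \<comment> \<open>Two indices still in the list share the ratio \<open>c\<close>; otherwise one
      of them has left, and its ratio equation applies, with the roles exchanged if that one is
      \<open>y\<close>.\<close>
    proof (cases "x \<in> set T \<and> y \<in> set T")
      case True
      then show ?thesis using T[of x] T[of y] by simp
    next
      case not_both: False
      then show ?thesis using ratio[OF x y] ratio[OF y x] False entry_zero_iff[OF x y] by metis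
    qed
    then have "(d x * real_of_int (A $$ (x,y))) * e y = d y * (e x * real_of_int (A $$ (x,y)))"
      by (simp add: mult.commute mult.left_commute)
    also have "\<dots> = (d y * real_of_int (A $$ (y,x))) * e y"
      using weight_symm[OF x y] by simp
    finally show ?thesis using weight_pos[OF y] by simp
  qed
qed

end

text \<open>Used in both directions: to read weights off a given symmetrizer and to verify the
  computed one.\<close>

lemma symmetric_diag_mult_iff:
  fixes B :: "real mat"
  assumes "B \<in> carrier_mat n n" "D \<in> carrier_mat n n" "diagonal_mat D"
  shows "transpose_mat (D * B) = D * B \<longleftrightarrow>
    (\<forall>x < n. \<forall>y < n. D $$ (x,x) * B $$ (x,y) = D $$ (y,y) * B $$ (y,x))"
proof -
  have "(D * B) $$ (x,y) = D $$ (x,x) * B $$ (x,y)" if "x < n" "y < n" for x y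
  proof -
    have "(D * B) $$ (x,y) = (\<Sum>k = 0..<n. D $$ (x,k) * B $$ (k,y))"
      using that assms by (auto simp: scalar_prod_def)
    also have "\<dots> = (\<Sum>k = 0..<n. if k = x then D $$ (x,x) * B $$ (x,y) else 0)"
      using that assms by (intro sum.cong) (auto simp: diagonal_mat_def)
    finally show ?thesis using that by simp
  qed
  then show ?thesis using assms by (auto simp: mat_eq_iff)
qed

theorem proposition3p4:
  fixes n :: nat and A :: "int mat"
  assumes "n \<ge> 1"
    and "A \<in> carrier_mat n n"
    and "symmetrizable A"
  shows "\<exists>D. SymmetrizerMatrix A = Some D \<and>
           D \<in> carrier_mat n n \<and> diagonal_mat D \<and> (\<forall>i < n. D $$ (i,i) > 0) \<and>
           transpose_mat (D * map_mat real_of_int A) = D * map_mat real_of_int A"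
proof -
  have B: "map_mat real_of_int A \<in> carrier_mat n n" using assms(2) by simp
  obtain E where E: "E \<in> carrier_mat n n" "diagonal_mat E" "\<forall>x < n. E $$ (x,x) > 0"
      "transpose_mat (E * map_mat real_of_int A) = E * map_mat real_of_int A"
    using assms(2,3) by (auto simp: symmetrizable_def symmetrizer_def)
  interpret symmetrizing_weights A n "\<lambda>x. E $$ (x,x)"
    using E(3) symmetric_diag_mult_iff[OF B E(1,2)] E(4) assms(2) by unfold_locales auto
  obtain d T where run:
      "while_option (\<lambda>(d, S, T). S \<noteq> {}) (sm_step A) (sm_init n) = Some (d, {}, T)"
    and inv: "sm_invariant (d, {}, T)"
    using sm_loop_terminates by auto
  have D: "mat_diag n d \<in> carrier_mat n n" "diagonal_mat (mat_diag n d)"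
    by (auto simp: mat_diag_def diagonal_mat_def)
  have "SymmetrizerMatrix A = Some (mat_diag n d)"
    using run assms(2) by (simp add: SymmetrizerMatrix_def)
  moreover have "\<forall>i < n. mat_diag n d $$ (i,i) > 0"
    using sm_invariant_final(1)[OF inv] by (simp add: mat_diag_def)
  moreover have "transpose_mat (mat_diag n d * map_mat real_of_int A) =
      mat_diag n d * map_mat real_of_int A"
    using symmetric_diag_mult_iff[OF B D] sm_invariant_final(2)[OF inv] assms(2)
    by (simp add: mat_diag_def)
  ultimately show ?thesis using D by blast
qed

end
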